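(* Let $d\geq 4$ and $b=\frac{d-1}{d}$. There exist a function $\varepsilon:\mathbb{N}\to\mathbb{R}$ with $\varepsilon(n)\to 0$ as $n\to\infty$ and an integer $n_0$ such that for every $n\geq n_0$, setting $a=(d+1)(1+\varepsilon(n))$, the following holds: for every integer $N$ with $0\leq N\leq \binom{\lfloor n-an^{b}\rfloor}{d}$ there exists an arrangement $\mathcal{A}$ of $n$ distinct hyperplanes in $\mathbb{RP}^d$ with exactly $f_{max}(n,d)-N$ regions such that any $d$ hyperplanes of $\mathcal{A}$ intersect in exactly one point (i.e. all intersections of dimension at least one are the same as in an arrangement in general position, and the only deviations from general position are points incident to more than $d$ hyperplanes).
   Context: An arrangement of $n$ hyperplanes in real projective space $\mathbb{RP}^d$ is a set of $n$ distinct projective hyperplanes. Its number of regions is the number of connected components of the complement in $\mathbb{RP}^d$ of the union of its hyperplanes. An arrangement is in general position if any $k\le d$ of its hyperplanes intersect in a subspace of codimension $k$ and no $d+1$ of them have a common point. $f_{max}(n,d)$ denotes the maximal possible number of regions of an arrangement of $n$ hyperplanes in $\mathbb{RP}^d$; for $n\geq d+1$ it equals $\sum_{i=0}^{d}\binom{n-1}{i}$. *)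

theory Defs
  imports "HOL-Analysis.Analysis"
begin

text \<open>
  The real projective space of a Euclidean space: its points are the lines through the origin.
  For \<^typ>\<open>real ^ 'n\<close> with \<open>CARD('n) = d + 1\<close> this is $d$-dimensional real projective space.
\<close>

typedef (overloaded) 'a rproj = "{l :: 'a::euclidean_space set. subspace l \<and> dim l = 1}"
  morphisms line_of Abs_rproj
proof -
  obtain b :: 'a where "b \<in> Basis"
    using nonempty_Basis by blast
  then have "b \<noteq> 0"
    by (rule nonzero_Basis)
  then have "dim (span {b}) = 1"
    unfolding dim_span by (simp only: dim_singleton if_False)
  then have "span {b} \<in> {l. subspace l \<and> dim l = 1}"
    by (intro CollectI conjI subspace_span)
  then show ?thesis
    by (rule exI)
qed

definition rproj_class :: "'a::euclidean_space \<Rightarrow> 'a rproj" where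
  "rproj_class x = Abs_rproj (span {x})"

text \<open>
  The topology is the quotient topology along \<^const>\<open>rproj_class\<close>, restricted to the nonzero
  vectors. As these form an open set, openness of a preimage may be tested in the whole space.
\<close>

instantiation rproj :: (euclidean_space) topological_space
begin

definition open_rproj :: "'a rproj set \<Rightarrow> bool" where
  "open_rproj U \<longleftrightarrow> open {x. x \<noteq> 0 \<and> rproj_class x \<in> U}"

instance
proof
  have "{x :: 'a. x \<noteq> 0 \<and> rproj_class x \<in> UNIV} = - {0}"
    by blast
  then show "open (UNIV :: 'a rproj set)"
    unfolding open_rproj_def by (simp only: open_Compl closed_singleton)
next
  fix S T :: "'a rproj set"
  assume "open S" "open T"
  then have "open ({x. x \<noteq> 0 \<and> rproj_class x \<in> S} \<inter> {x. x \<noteq> 0 \<and> rproj_class x \<in> T})"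
    unfolding open_rproj_def by (rule open_Int)
  moreover have "{x. x \<noteq> 0 \<and> rproj_class x \<in> S} \<inter> {x. x \<noteq> 0 \<and> rproj_class x \<in> T} =
      {x. x \<noteq> 0 \<and> rproj_class x \<in> S \<inter> T}"
    by blast
  ultimately show "open (S \<inter> T)"
    unfolding open_rproj_def by (simp only:)
next
  fix K :: "'a rproj set set"
  assume "\<forall>S\<in>K. open S"
  then have "open (\<Union>S\<in>K. {x. x \<noteq> 0 \<and> rproj_class x \<in> S})"
    unfolding open_rproj_def by (rule open_UN)
  moreover have "(\<Union>S\<in>K. {x. x \<noteq> 0 \<and> rproj_class x \<in> S}) =
      {x. x \<noteq> 0 \<and> rproj_class x \<in> \<Union>K}"
    by blast
  ultimately show "open (\<Union>K)"
    unfolding open_rproj_def by (simp only:)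
qed

end

definition rproj_hyperplane :: "'a::euclidean_space rproj set \<Rightarrow> bool" where
  "rproj_hyperplane H \<longleftrightarrow>
     (\<exists>W. subspace W \<and> dim W + 1 = DIM('a) \<and> H = {p. line_of p \<subseteq> W})"

definition arrangement :: "nat \<Rightarrow> 'a::euclidean_space rproj set set \<Rightarrow> bool" where
  "arrangement n \<A> \<longleftrightarrow> finite \<A> \<and> card \<A> = n \<and> (\<forall>H\<in>\<A>. rproj_hyperplane H)"

definition num_regions :: "'a::euclidean_space rproj set set \<Rightarrow> nat" where
  "num_regions \<A> = card (components (- \<Union>\<A>))"

text \<open>
  The maximal number of regions of \<open>n\<close> hyperplanes; the type argument fixes the dimension.
  An arrangement of \<open>n\<close> hyperplanes has at most \<open>2 ^ n\<close> regions, so the maximum is over a finite set.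
\<close>

definition f_max :: "'a::euclidean_space itself \<Rightarrow> nat \<Rightarrow> nat" where
  "f_max _ n = Max {num_regions \<A> | \<A> :: 'a rproj set set. arrangement n \<A>}"

end

theory Submission
  imports Defs "HOL-Real_Asymp.Real_Asymp"
begin

text \<open>
  Partition the hyperplanes into classes, fix a point for every class, and choose the hyperplanes
  generically among those through the point of their class. If any \<open>d\<close> hyperplanes are independent
  and \<open>d + 1\<close> of them are dependent only within a class, then by deletion and restriction a class of
  size \<open>k\<close> costs exactly \<open>(k - 1) choose d\<close> regions compared with general position.
  It remains to write \<open>N\<close> as a sum of binomials \<open>x choose d\<close> with the sum of all \<open>x + 1\<close> at most \<open>n\<close>.
  The greedy expansion does this: after a first term \<open>x \<le> n - (d + 1) n\<^sup>b\<close> the remainder is below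
  \<open>x choose (d - 1)\<close>, and the further terms need less than \<open>5 n\<^sup>b \<le> (d + 1) n\<^sup>b\<close> hyperplanes.
  So \<open>\<epsilon> = 0\<close> suffices.
\<close>

section \<open>Cells of a central arrangement\<close>

definition common_kernel :: "('i \<Rightarrow> 'a::euclidean_space) \<Rightarrow> 'i set \<Rightarrow> 'a set" where
  "common_kernel v J = {x. \<forall>i\<in>J. v i \<bullet> x = 0}"

definition sign_cell :: "('i \<Rightarrow> 'a::euclidean_space) \<Rightarrow> 'i set \<Rightarrow> 'i set \<Rightarrow> 'a set" where
  "sign_cell v I s = {x. \<forall>i\<in>I. if i \<in> s then v i \<bullet> x > 0 else v i \<bullet> x < 0}"

text \<open>A cell is identified with its set of indices of positive sign. The subspace
  \<open>W\<close> is a parameter so that restricting to a hyperplane keeps the normals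
  \<open>v\<close> unchanged, even if several of them cut \<open>W\<close> in the same
  hyperplane.\<close>

definition sign_sets :: "('i \<Rightarrow> 'a::euclidean_space) \<Rightarrow> 'i set \<Rightarrow> 'a set \<Rightarrow> 'i set set" where
  "sign_sets v I W = {s. s \<subseteq> I \<and> W \<inter> sign_cell v I s \<noteq> {}}"

text \<open>The classical count for \<open>n\<close> generic central hyperplanes in dimension
  \<open>w\<close>. The case \<open>n = 0\<close> is separate because truncated subtraction would
  yield 2 instead of the single cell when \<open>w > 0\<close>.\<close>

definition max_cells :: "nat \<Rightarrow> nat \<Rightarrow> nat" where
  "max_cells n w = (if n = 0 then 1 else 2 * (\<Sum>j<w. (n - 1) choose j))"

lemma subspace_common_kernel: "subspace (common_kernel v J)"
  by (auto simp: common_kernel_def subspace_def inner_add_right)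

lemma common_kernel_insert:
  "common_kernel v (insert i J) = {x. v i \<bullet> x = 0} \<inter> common_kernel v J"
  by (auto simp: common_kernel_def)

lemma common_kernel_empty [simp]: "common_kernel v {} = UNIV"
  by (simp add: common_kernel_def)

text \<open>Pascal's rule in the form of deletion and restriction: dropping one hyperplane gives the
  first summand, restricting to it the second.\<close>

lemma max_cells_Suc_Suc: "max_cells (Suc n) (Suc w) = max_cells n (Suc w) + max_cells n w"
proof (cases n)
  case 0
  have "(\<Sum>j<Suc w. 0 choose j) = (1::nat)"
    by (subst sum.lessThan_Suc_shift) simp
  then show ?thesis
    using 0 by (simp add: max_cells_def del: sum.lessThan_Suc)
next
  case (Suc m)
  have "(\<Sum>j<Suc w. Suc m choose j) = 1 + (\<Sum>j<w. m choose j) + (\<Sum>j<w. m choose Suc j)"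
    by (subst sum.lessThan_Suc_shift) (simp add: sum.distrib)
  also have "1 + (\<Sum>j<w. m choose j) + (\<Sum>j<w. m choose Suc j) =
      (\<Sum>j<Suc w. m choose j) + (\<Sum>j<w. m choose j)"
    unfolding sum.lessThan_Suc_shift[of _ w] by simp
  finally show ?thesis
    using Suc by (simp add: max_cells_def del: sum.lessThan_Suc)
qed

lemma max_cells_0_right: "n > 0 \<Longrightarrow> max_cells n 0 = 0"
  by (simp add: max_cells_def)

lemma open_sign_cell:
  assumes "finite I"
  shows "open (sign_cell v I s)"
proof -
  have "sign_cell v I s = (\<Inter>i\<in>I. if i \<in> s then {x. v i \<bullet> x > 0} else {x. v i \<bullet> x < 0})"
    by (auto simp: sign_cell_def)
  then show ?thesis
    using assms by (auto intro!: open_INT simp: open_halfspace_lt open_halfspace_gt)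
qed

text \<open>Either weight may vanish, so this covers convexity, positive scaling and, with suitable
  weights, reaching a hyperplane between two points.\<close>

lemma sign_cell_pos_combination:
  assumes "x \<in> sign_cell v I s" "y \<in> sign_cell v I s" "a \<ge> 0" "b \<ge> 0" "a + b > (0::real)"
  shows "a *\<^sub>R x + b *\<^sub>R y \<in> sign_cell v I s"
proof -
  have pos: "a * p + b * q > 0" if "p > 0" "q > 0" for p q :: real
  proof (cases "a = 0")
    case False
    then show ?thesis
      using assms that by (intro add_pos_nonneg mult_pos_pos) auto
  qed (use assms that in simp)
  have neg: "a * p + b * q < 0" if "p < 0" "q < 0" for p q :: real
    using pos[of "-p" "-q"] that by simp
  show ?thesis
    using assms(1,2) unfolding sign_cell_def
    by (auto simp: inner_add_right intro: pos neg)
qed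

lemma sign_cell_unique:
  assumes "x \<in> sign_cell v I s" "x \<in> sign_cell v I t" "s \<subseteq> I" "t \<subseteq> I"
  shows "s = t"
proof -
  have "i \<in> s \<longleftrightarrow> i \<in> t" if "i \<in> I" for i
    using assms(1,2) that unfolding sign_cell_def by (auto dest!: bspec split: if_splits)
  then show ?thesis
    using assms(3,4) by blast
qed

lemma finite_sign_sets: "finite I \<Longrightarrow> finite (sign_sets v I W)"
  by (rule finite_subset[of _ "Pow I"]) (auto simp: sign_sets_def)

lemma sign_cell_insert:
  assumes "i \<notin> I" "s \<subseteq> I"
  shows "sign_cell v (insert i I) s = sign_cell v I s \<inter> {x. v i \<bullet> x < 0}"
    and "sign_cell v (insert i I) (insert i s) = sign_cell v I s \<inter> {x. v i \<bullet> x > 0}"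
  using assms by (auto simp: sign_cell_def split: if_splits)

lemma sign_cell_perturb:
  assumes "finite I" "x \<in> sign_cell v I s"
  obtains t where "t > 0" "x + t *\<^sub>R z \<in> sign_cell v I s" "x - t *\<^sub>R z \<in> sign_cell v I s"
proof -
  obtain e where e: "e > 0" "ball x e \<subseteq> sign_cell v I s"
    using open_sign_cell[OF assms(1)] assms(2) open_contains_ball by blast
  define t where "t = e / (2 * (norm z + 1))"
  have "t > 0"
    using e(1) by (simp add: t_def add_nonneg_pos)
  moreover have "t * norm z < e"
  proof -
    have "t * norm z < t * (2 * (norm z + 1))"
      using \<open>t > 0\<close> norm_ge_zero[of z] by (simp del: norm_ge_zero)
    also have "\<dots> = e"
      using add_nonneg_pos[of "norm z" 1] by (simp add: t_def divide_simps)
    finally show ?thesis .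
  qed
  ultimately have "x + t *\<^sub>R z \<in> ball x e" "x - t *\<^sub>R z \<in> ball x e"
    by (auto simp: dist_norm)
  then show ?thesis
    using that \<open>t > 0\<close> e(2) by blast
qed

text \<open>Deletion and restriction: a cell of the smaller arrangement is cut in two by the new
  hyperplane iff it meets that hyperplane.\<close>

lemma card_sign_sets_insert:
  assumes "finite I" "i \<notin> I" "subspace W" "z \<in> W" "v i \<bullet> z \<noteq> 0"
  shows "card (sign_sets v (insert i I) W) =
    card (sign_sets v I W) + card (sign_sets v I ({x. v i \<bullet> x = 0} \<inter> W))"
proof -
  \<comment> \<open>\<open>A\<close> and \<open>B\<close> collect the old cells meeting the negative
    and the positive side. The new cells number \<open>card A + card B\<close>, so
    inclusion-exclusion reduces everything to \<open>A \<union> B\<close> and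
    \<open>A \<inter> B\<close>.\<close>
  define A where "A = {s. s \<subseteq> I \<and> W \<inter> sign_cell v I s \<inter> {x. v i \<bullet> x < 0} \<noteq> {}}"
  define B where "B = {s. s \<subseteq> I \<and> W \<inter> sign_cell v I s \<inter> {x. v i \<bullet> x > 0} \<noteq> {}}"
  have fin: "finite A" "finite B"
    using assms(1) by (auto simp: A_def B_def)
  \<comment> \<open>Cells are open, so a point on the hyperplane can be moved along \<open>z\<close>
    in both directions without leaving its cell.\<close>
  have on_hyperplane: "s \<in> A \<inter> B"
    if s: "s \<subseteq> I" "x \<in> W" "x \<in> sign_cell v I s" "v i \<bullet> x = 0" for s x
  proof -
    obtain t where t: "t > 0" "x + t *\<^sub>R z \<in> sign_cell v I s" "x - t *\<^sub>R z \<in> sign_cell v I s"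
      using sign_cell_perturb[OF assms(1) s(3)] by metis
    have W: "x + t *\<^sub>R z \<in> W" "x - t *\<^sub>R z \<in> W"
      using assms(3,4) s(2) by (auto intro: subspace_add subspace_diff subspace_mul)
    have vals: "v i \<bullet> (x + t *\<^sub>R z) = t * (v i \<bullet> z)" "v i \<bullet> (x - t *\<^sub>R z) = - (t * (v i \<bullet> z))"
      using s(4) by (simp_all add: inner_add_right inner_diff_right)
    show ?thesis
    proof (cases "v i \<bullet> z > 0")
      case True
      then have "v i \<bullet> (x + t *\<^sub>R z) > 0" "v i \<bullet> (x - t *\<^sub>R z) < 0"
        using t(1) unfolding vals by simp_all
      then show ?thesis
        using t W s(1) unfolding A_def B_def by blast
    next
      case False
      then have "v i \<bullet> z < 0"
        using assms(5) by simp
      then have "v i \<bullet> (x + t *\<^sub>R z) < 0" "v i \<bullet> (x - t *\<^sub>R z) > 0"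
        using t(1) unfolding vals by (simp_all add: mult_pos_neg)
      then show ?thesis
        using t W s(1) unfolding A_def B_def by blast
    qed
  qed
  have union: "A \<union> B = sign_sets v I W"
  proof
    show "A \<union> B \<subseteq> sign_sets v I W"
      by (auto simp: A_def B_def sign_sets_def)
    show "sign_sets v I W \<subseteq> A \<union> B"
    proof
      fix s assume "s \<in> sign_sets v I W"
      then obtain x where x: "s \<subseteq> I" "x \<in> W" "x \<in> sign_cell v I s"
        by (auto simp: sign_sets_def)
      consider "v i \<bullet> x < 0" | "v i \<bullet> x > 0" | "v i \<bullet> x = 0"
        by linarith
      then show "s \<in> A \<union> B"
        using x on_hyperplane[OF x] by cases (auto simp: A_def B_def)
    qed
  qed
  have inter: "A \<inter> B = sign_sets v I ({x. v i \<bullet> x = 0} \<inter> W)"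
  proof
    show "sign_sets v I ({x. v i \<bullet> x = 0} \<inter> W) \<subseteq> A \<inter> B"
      using on_hyperplane unfolding sign_sets_def by blast
    show "A \<inter> B \<subseteq> sign_sets v I ({x. v i \<bullet> x = 0} \<inter> W)"
    proof
      fix s assume "s \<in> A \<inter> B"
      then obtain x y where s: "s \<subseteq> I"
        and x: "x \<in> W" "x \<in> sign_cell v I s" "v i \<bullet> x < 0"
        and y: "y \<in> W" "y \<in> sign_cell v I s" "v i \<bullet> y > 0"
        by (auto simp: A_def B_def)
      \<comment> \<open>The weights are positive and cancel the two values of \<open>v i\<close>,
        which puts \<open>u\<close> on the hyperplane.\<close>
      define u where "u = (v i \<bullet> y) *\<^sub>R x + (- (v i \<bullet> x)) *\<^sub>R y"
      have "u \<in> sign_cell v I s"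
        unfolding u_def using x y by (intro sign_cell_pos_combination) auto
      moreover have "u \<in> W"
        unfolding u_def using assms(3) x y by (intro subspace_add subspace_mul)
      moreover have "v i \<bullet> u = 0"
        by (simp add: u_def inner_add_right inner_diff_right algebra_simps)
      ultimately show "s \<in> sign_sets v I ({x. v i \<bullet> x = 0} \<inter> W)"
        using s by (auto simp: sign_sets_def)
    qed
  qed
  have "sign_sets v (insert i I) W = A \<union> insert i ` B"
  proof (intro set_eqI iffI)
    fix s assume s: "s \<in> sign_sets v (insert i I) W"
    show "s \<in> A \<union> insert i ` B"
    proof (cases "i \<in> s")
      case True
      then obtain t where t: "s = insert i t" "i \<notin> t"
        using mk_disjoint_insert by metis
      then have "t \<subseteq> I"
        using s by (auto simp: sign_sets_def)
      moreover have "W \<inter> sign_cell v (insert i I) (insert i t) \<noteq> {}"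
        using s t(1) by (simp add: sign_sets_def)
      ultimately have "t \<in> B"
        unfolding B_def sign_cell_insert(2)[OF assms(2) \<open>t \<subseteq> I\<close>] by (simp add: Int_assoc)
      then show ?thesis
        using t(1) by blast
    next
      case False
      then have "s \<subseteq> I"
        using s by (auto simp: sign_sets_def)
      then show ?thesis
        using s sign_cell_insert(1)[OF assms(2), of s v] by (auto simp: sign_sets_def A_def)
    qed
  next
    fix s assume "s \<in> A \<union> insert i ` B"
    then show "s \<in> sign_sets v (insert i I) W"
      using sign_cell_insert[OF assms(2), of _ v] by (auto simp: sign_sets_def A_def B_def)
  qed
  moreover have "A \<inter> insert i ` B = {}"
    using assms(2) by (auto simp: A_def)
  moreover have "inj_on (insert i) B"
  proof (rule inj_onI)
    fix s t assume "s \<in> B" "t \<in> B" "insert i s = insert i t"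
    moreover from this have "i \<notin> s" "i \<notin> t"
      using assms(2) by (auto simp: B_def)
    ultimately show "s = t"
      by (simp add: insert_ident)
  qed
  ultimately have "card (sign_sets v (insert i I) W) = card A + card B"
    using fin by (simp add: card_Un_disjoint card_image)
  also have "\<dots> = card (A \<union> B) + card (A \<inter> B)"
    by (rule card_Un_Int[OF fin])
  finally show ?thesis
    unfolding union inter .
qed

section \<open>Cell counts: upper bound, generic families, one pencil, several pencils\<close>

lemma sign_sets_empty: "W \<noteq> {} \<Longrightarrow> sign_sets v {} W = {{}}"
  by (auto simp: sign_sets_def sign_cell_def)

lemma sign_sets_trivial:
  assumes "i \<in> I" "\<And>x. x \<in> W \<Longrightarrow> v i \<bullet> x = 0"
  shows "sign_sets v I W = {}"
  using assms unfolding sign_sets_def sign_cell_def by force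

lemma dim_hyperplane_Int:
  fixes W :: "'a::euclidean_space set"
  assumes "subspace W" "z \<in> W" "a \<bullet> z \<noteq> 0"
  shows "dim W = Suc (dim ({x. a \<bullet> x = 0} \<inter> W))"
proof -
  let ?H = "{x. a \<bullet> x = 0}"
  have [simp]: "subspace ?H" by (rule subspace_hyperplane)
  have "a \<noteq> 0" using assms(3) by auto
  \<comment> \<open>Subtracting a multiple of \<open>z\<close> moves any vector into
    \<open>?H\<close>, so \<open>?H\<close> and \<open>W\<close> together span the space.\<close>
  have "dim {x + y |x y. x \<in> ?H \<and> y \<in> W} = DIM('a)"
  proof -
    have "x \<in> {x + y |x y. x \<in> ?H \<and> y \<in> W}" for x
    proof -
      have "x - ((a \<bullet> x) / (a \<bullet> z)) *\<^sub>R z \<in> ?H"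
        using assms(3) by (simp add: inner_diff_right)
      moreover have "((a \<bullet> x) / (a \<bullet> z)) *\<^sub>R z \<in> W"
        using assms by (simp add: subspace_mul)
      ultimately show ?thesis
        by (smt (verit) diff_add_cancel mem_Collect_eq)
    qed
    then have "{x + y |x y. x \<in> ?H \<and> y \<in> W} = UNIV" by blast
    then show ?thesis by simp
  qed
  moreover have "dim {x + y |x y. x \<in> ?H \<and> y \<in> W} + dim (?H \<inter> W) = dim ?H + dim W"
    using assms(1) by (intro dim_sums_Int) simp_all
  ultimately show ?thesis
    using dim_hyperplane[OF \<open>a \<noteq> 0\<close>] DIM_positive[where 'a='a] by linarith
qed

text \<open>Deletion and restriction reproduce the recursion of \<open>max_cells\<close> as an
  inequality. If \<open>v i\<close> vanishes on \<open>W\<close>, the strict sign conditions leave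
  no cell at all.\<close>

lemma card_sign_sets_le:
  fixes v :: "'i \<Rightarrow> 'a::euclidean_space"
  assumes "finite I" "subspace W"
  shows "card (sign_sets v I W) \<le> max_cells (card I) (dim W)"
  using assms
proof (induction I arbitrary: W rule: finite_induct)
  case empty
  then have "W \<noteq> {}" using subspace_0 by blast
  then show ?case by (simp add: sign_sets_empty max_cells_def)
next
  case (insert i I)
  show ?case
  proof (cases "\<exists>z\<in>W. v i \<bullet> z \<noteq> 0")
    case True
    then obtain z where z: "z \<in> W" "v i \<bullet> z \<noteq> 0" by blast
    let ?W = "{x. v i \<bullet> x = 0} \<inter> W"
    have "subspace ?W"
      using insert.prems by (simp add: subspace_inter subspace_hyperplane)
    then have "card (sign_sets v I W) + card (sign_sets v I ?W)
        \<le> max_cells (card I) (dim W) + max_cells (card I) (dim ?W)"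
      using insert by (intro add_mono) auto
    then show ?thesis
      using insert z card_sign_sets_insert[of I i W z v] dim_hyperplane_Int[of W z "v i"]
        max_cells_Suc_Suc[of "card I" "dim ?W"] by simp
  next
    case False
    then show ?thesis
      by (subst sign_sets_trivial[of i]) auto
  qed
qed

text \<open>Genericity passes to the restriction by applying the hypothesis to
  \<open>insert i J\<close>, so the recursion holds with equality throughout.\<close>

lemma card_sign_sets_generic:
  fixes v :: "'i \<Rightarrow> 'a::euclidean_space"
  assumes "finite I" "subspace W"
    and "\<And>J. J \<subseteq> I \<Longrightarrow> card J \<le> dim W \<Longrightarrow> dim (common_kernel v J \<inter> W) + card J = dim W"
  shows "card (sign_sets v I W) = max_cells (card I) (dim W)"
  using assms
proof (induction I arbitrary: W rule: finite_induct)
  case empty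
  then have "W \<noteq> {}" using subspace_0 by blast
  then show ?case by (simp add: sign_sets_empty max_cells_def)
next
  case (insert i I)
  let ?W = "{x. v i \<bullet> x = 0} \<inter> W"
  show ?case
  proof (cases "dim W = 0")
    case True
    then have "W \<subseteq> {0}" by simp
    then have "sign_sets v (insert i I) W = {}"
      by (intro sign_sets_trivial[of i]) auto
    then show ?thesis
      unfolding True using insert.hyps by (simp add: max_cells_0_right)
  next
    case False
    then have "card {i} \<le> dim W"
      by (simp del: dim_eq_0)
    then have "dim ?W + 1 = dim W"
      using insert.prems(2)[of "{i}"] by (simp add: common_kernel_insert)
    moreover from this have "\<not> W \<subseteq> {x. v i \<bullet> x = 0}"
      by (metis inf.absorb2 add_cancel_left_right one_neq_zero)
    then obtain z where z: "z \<in> W" "v i \<bullet> z \<noteq> 0" by blast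
    have "card (sign_sets v I W) = max_cells (card I) (dim W)"
      using insert.prems by (intro insert.IH) auto
    moreover have "card (sign_sets v I ?W) = max_cells (card I) (dim ?W)"
    proof (rule insert.IH)
      show "subspace ?W"
        using insert.prems by (simp add: subspace_inter subspace_hyperplane)
      fix J assume J: "J \<subseteq> I" "card J \<le> dim ?W"
      then have "finite J" "i \<notin> J"
        using insert.hyps finite_subset by auto
      then have "card (insert i J) = Suc (card J)" by simp
      moreover have kernel: "common_kernel v (insert i J) \<inter> W = common_kernel v J \<inter> ?W"
        unfolding common_kernel_insert by blast
      ultimately show "dim (common_kernel v J \<inter> ?W) + card J = dim ?W"
        using insert.prems(2)[of "insert i J"] J \<open>dim ?W + 1 = dim W\<close>
        unfolding kernel by (simp add: subset_insertI2)
    qed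
    ultimately show ?thesis
      using insert z card_sign_sets_insert[of I i W z v] max_cells_Suc_Suc[of "card I" "dim ?W"] by simp
  qed
qed

text \<open>The hyperplanes in \<open>K\<close> all contain \<open>p\<close>, so their cells are
  those of a generic family in the complement of \<open>p\<close>, one dimension lower; the loss is
  the last binomial term of \<open>max_cells\<close>, doubled. Every further hyperplane carries a
  generic restriction and leaves the loss unchanged.\<close>

lemma card_sign_sets_one_pencil:
  fixes v :: "'i \<Rightarrow> 'a::euclidean_space"
  assumes "finite I" "subspace W" "dim W \<ge> 2" "K \<subseteq> I"
    and "p \<in> W" "p \<noteq> 0" "\<And>k. k \<in> K \<Longrightarrow> v k \<bullet> p = 0"
    and "\<And>J. J \<subseteq> I \<Longrightarrow> card J \<le> dim W \<Longrightarrow> card J < dim W \<or> \<not> J \<subseteq> K \<Longrightarrow>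
      dim (common_kernel v J \<inter> W) + card J = dim W"
  shows "card (sign_sets v I W) + 2 * ((card K - 1) choose (dim W - 1)) = max_cells (card I) (dim W)"
proof -
  have finK: "finite K"
    using assms finite_subset by blast
  have base: "card (sign_sets v K W) + 2 * ((card K - 1) choose (dim W - 1)) = max_cells (card K) (dim W)"
  proof -
    let ?W = "{x. p \<bullet> x = 0} \<inter> W"
    have W: "dim W = Suc (dim ?W)"
      using assms by (intro dim_hyperplane_Int) auto
    have "sign_sets v K W = sign_sets v K ?W"
    proof
      show "sign_sets v K ?W \<subseteq> sign_sets v K W"
        by (auto simp: sign_sets_def)
      show "sign_sets v K W \<subseteq> sign_sets v K ?W"
      proof
        fix s assume "s \<in> sign_sets v K W"
        then obtain x where x: "s \<subseteq> K" "x \<in> W" "x \<in> sign_cell v K s"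
          by (auto simp: sign_sets_def)
        \<comment> \<open>Projecting \<open>x\<close> off \<open>p\<close> changes no value
          \<open>v k \<bullet> x\<close> with \<open>k \<in> K\<close>.\<close>
        define y where "y = x - ((p \<bullet> x) / (p \<bullet> p)) *\<^sub>R p"
        have "y \<in> W"
          using assms x by (auto simp: y_def intro!: subspace_diff subspace_mul)
        moreover have "p \<bullet> y = 0"
          using assms(6) by (simp add: y_def inner_diff_right)
        moreover have "v k \<bullet> y = v k \<bullet> x" if "k \<in> K" for k
          using assms(7)[OF that] by (simp add: y_def inner_diff_right)
        then have "y \<in> sign_cell v K s"
          using x(3) by (auto simp: sign_cell_def)
        ultimately show "s \<in> sign_sets v K ?W"
          using x(1) by (auto simp: sign_sets_def)
      qed
    qed
    also have "card \<dots> = max_cells (card K) (dim ?W)"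
    proof (rule card_sign_sets_generic[OF finK])
      show "subspace ?W"
        using assms by (simp add: subspace_inter subspace_hyperplane)
      fix J assume J: "J \<subseteq> K" "card J \<le> dim ?W"
      then have "dim (common_kernel v J \<inter> W) + card J = dim W"
        using W assms(4,8) by auto
      moreover have "dim (common_kernel v J \<inter> W) = Suc (dim ({x. p \<bullet> x = 0} \<inter> (common_kernel v J \<inter> W)))"
      proof (rule dim_hyperplane_Int)
        show "subspace (common_kernel v J \<inter> W)"
          using assms by (intro subspace_inter subspace_common_kernel)
        show "p \<in> common_kernel v J \<inter> W"
          using assms J by (auto simp: common_kernel_def)
      qed (use assms in simp)
      ultimately show "dim (common_kernel v J \<inter> ?W) + card J = dim ?W"
        using W by (simp add: Int_ac)
    qed
    finally show ?thesis
      using W assms(3) by (auto simp: max_cells_def binomial_eq_0)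
  qed
  have "finite (I - K)"
    using assms(1) by simp
  moreover have "card (sign_sets v (K \<union> L) W) + 2 * ((card K - 1) choose (dim W - 1)) = max_cells (card (K \<union> L)) (dim W)"
    if "L \<subseteq> I - K" "finite L" for L
    using that(2,1)
  proof (induction L rule: finite_induct)
    case empty
    then show ?case using base by simp
  next
    case (insert i L)
    let ?W = "{x. v i \<bullet> x = 0} \<inter> W"
    have "dim (common_kernel v {i} \<inter> W) + 1 = dim W"
      using insert assms(3) by (subst assms(8)[symmetric, of "{i}"]) auto
    then have dimW: "dim ?W + 1 = dim W"
      by (simp add: common_kernel_insert)
    then have "\<not> W \<subseteq> {x. v i \<bullet> x = 0}"
      by (metis inf.absorb2 add_cancel_left_right one_neq_zero)
    then obtain z where z: "z \<in> W" "v i \<bullet> z \<noteq> 0" by blast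
    \<comment> \<open>A family containing \<open>i\<close> is not inside \<open>K\<close>, so on
      \<open>?W\<close> all families of at most \<open>dim ?W\<close> normals are
      independent.\<close>
    have "card (sign_sets v (K \<union> L) ?W) = max_cells (card (K \<union> L)) (dim ?W)"
    proof (rule card_sign_sets_generic)
      show "finite (K \<union> L)" using finK insert by simp
      show "subspace ?W"
        using assms by (simp add: subspace_inter subspace_hyperplane)
      fix J assume J: "J \<subseteq> K \<union> L" "card J \<le> dim ?W"
      then have "finite J" "i \<notin> J"
        using insert finK by (auto intro: finite_subset[of _ "K \<union> L"])
      then have "card (insert i J) = Suc (card J)" by simp
      moreover have "insert i J \<subseteq> I" "\<not> insert i J \<subseteq> K"
        using J insert.prems assms(4) by auto
      moreover have "common_kernel v (insert i J) \<inter> W = common_kernel v J \<inter> ?W"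
        unfolding common_kernel_insert by blast
      ultimately show "dim (common_kernel v J \<inter> ?W) + card J = dim ?W"
        using assms(8)[of "insert i J"] J(2) dimW by simp
    qed
    moreover have "card (sign_sets v (insert i (K \<union> L)) W) =
        card (sign_sets v (K \<union> L) W) + card (sign_sets v (K \<union> L) ?W)"
      using insert finK assms z by (intro card_sign_sets_insert) auto
    moreover have "card (insert i (K \<union> L)) = Suc (card (K \<union> L))"
      using insert finK by simp
    ultimately show ?case
      using insert dimW max_cells_Suc_Suc[of "card (K \<union> L)" "dim ?W"] by simp
  qed
  from this[of "I - K"] show ?thesis
    using assms by (simp add: Un_absorb1)
qed

text \<open>A colouring \<open>c\<close> of the hyperplanes prescribes the dependent families of at most
  \<open>DIM('a)\<close> normals: exactly the monochromatic ones of full size, whose hyperplanes share the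
  point \<open>p (c i)\<close>. A colour used fewer than \<open>DIM('a)\<close> times costs no cells.\<close>

definition pencil_generic :: "('i \<Rightarrow> 'a::euclidean_space) \<Rightarrow> ('c \<Rightarrow> 'a) \<Rightarrow> ('i \<Rightarrow> 'c) \<Rightarrow> 'i set \<Rightarrow> bool" where
  "pencil_generic v p c I \<longleftrightarrow> (\<forall>i\<in>I. v i \<bullet> p (c i) = 0) \<and>
    (\<forall>J\<subseteq>I. card J \<le> DIM('a) \<longrightarrow> card J < DIM('a) \<or> (\<nexists>k. \<forall>i\<in>J. c i = k) \<longrightarrow>
      dim (common_kernel v J) + card J = DIM('a))"

lemma pencil_generic_subset: "pencil_generic v p c I \<Longrightarrow> J \<subseteq> I \<Longrightarrow> pencil_generic v p c J"
  unfolding pencil_generic_def by (meson subset_iff)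

text \<open>Restricting to hyperplane \<open>i\<close> leaves only the colour of \<open>i\<close>
  degenerate: a family of another colour is no longer monochromatic once \<open>i\<close> joins it.
  The loss on the restriction is that of one pencil, and Pascal's rule adds it to the loss of this
  colour.\<close>

lemma card_sign_sets_pencils:
  fixes v :: "'i \<Rightarrow> 'a::euclidean_space"
  assumes "finite I" "finite C" "c ` I \<subseteq> C" "DIM('a) \<ge> 3"
    and "\<And>k. p k \<noteq> 0" "pencil_generic v p c I"
  shows "card (sign_sets v I UNIV) + 2 * (\<Sum>k\<in>C. (card {i\<in>I. c i = k} - 1) choose (DIM('a) - 1)) =
    max_cells (card I) DIM('a)"
  using assms(1,3,6)
proof (induction I rule: finite_induct)
  case empty
  then show ?case using assms(4) by (simp add: sign_sets_empty max_cells_def)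
next
  case (insert i I)
  let ?W = "{x. v i \<bullet> x = 0}"
  let ?K = "{j\<in>I. c j = c i}"
  let ?D = "DIM('a)"
  have gen: "dim (common_kernel v J) + card J = ?D"
    if "J \<subseteq> insert i I" "card J \<le> ?D" "card J < ?D \<or> (\<nexists>k. \<forall>i\<in>J. c i = k)" for J
    using insert.prems(2) that unfolding pencil_generic_def by blast
  have dimW: "dim ?W + 1 = ?D"
    using gen[of "{i}"] assms(4) by (simp add: common_kernel_insert)
  then have "\<not> UNIV \<subseteq> ?W"
    by (metis top.extremum_uniqueI dim_UNIV add_cancel_left_right one_neq_zero)
  then obtain z where z: "v i \<bullet> z \<noteq> 0" by blast
  have "card (sign_sets v I ?W) + 2 * ((card ?K - 1) choose (dim ?W - 1)) = max_cells (card I) (dim ?W)"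
  proof (rule card_sign_sets_one_pencil[where p = "p (c i)"])
    show "subspace ?W" by (rule subspace_hyperplane)
    show "dim ?W \<ge> 2" using dimW assms(4) by simp
    show "p (c i) \<in> ?W"
      using insert.prems(2) by (simp add: pencil_generic_def)
    show "v k \<bullet> p (c i) = 0" if "k \<in> ?K" for k
      using that insert.prems(2) unfolding pencil_generic_def by force
    fix J assume J: "J \<subseteq> I" "card J \<le> dim ?W" "card J < dim ?W \<or> \<not> J \<subseteq> ?K"
    then have "finite J" "i \<notin> J"
      using insert finite_subset by auto
    then have "card (insert i J) = Suc (card J)" by simp
    moreover have "insert i J \<subseteq> insert i I"
      "card (insert i J) < ?D \<or> (\<nexists>k. \<forall>j\<in>insert i J. c j = k)"
      using J dimW \<open>card (insert i J) = Suc (card J)\<close> by auto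
    ultimately have "dim (common_kernel v (insert i J)) + Suc (card J) = ?D"
      using gen[of "insert i J"] J dimW by simp
    then show "dim (common_kernel v J \<inter> ?W) + card J = dim ?W"
      using dimW by (simp add: common_kernel_insert Int_ac)
  qed (use insert assms in auto)
  moreover have "card (sign_sets v (insert i I) UNIV) =
      card (sign_sets v I UNIV) + card (sign_sets v I ({x. v i \<bullet> x = 0} \<inter> UNIV))"
    using insert z by (intro card_sign_sets_insert) auto
  moreover have "card (sign_sets v I UNIV) + 2 * (\<Sum>k\<in>C. (card {i\<in>I. c i = k} - 1) choose (?D - 1)) =
    max_cells (card I) ?D"
    using insert pencil_generic_subset[of v p c "insert i I" I] by auto
  moreover have "(\<Sum>k\<in>C. (card {j\<in>insert i I. c j = k} - 1) choose (?D - 1)) =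
    (\<Sum>k\<in>C. (card {i\<in>I. c i = k} - 1) choose (?D - 1)) + ((card ?K - 1) choose (dim ?W - 1))"
  proof -
    have C: "c i \<in> C" using insert by simp
    have other: "{j\<in>insert i I. c j = k} = {j\<in>I. c j = k}" if "k \<in> C - {c i}" for k
      using that by auto
    have "{j\<in>insert i I. c j = c i} = insert i ?K" by auto
    then have "card {j\<in>insert i I. c j = c i} = Suc (card ?K)"
      using insert by simp
    \<comment> \<open>As \<open>?D \<ge> 3\<close>, all lower indices are positive, so the truncated
      \<open>card ?K - 1\<close> is harmless when \<open>?K\<close> is empty.\<close>
    moreover have "card ?K choose (?D - 1) = ((card ?K - 1) choose (?D - 1)) + ((card ?K - 1) choose (dim ?W - 1))"
    proof -
      obtain e where e: "?D = Suc (Suc (Suc e))"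
        using assms(4) by (metis add_2_eq_Suc add_Suc_right le_Suc_ex numeral_3_eq_3 plus_nat.simps)
      then have "dim ?W = Suc (Suc e)" using dimW by simp
      then show ?thesis using e by (cases "card ?K") auto
    qed
    ultimately show ?thesis
      using other by (simp add: sum.remove[OF assms(2) C])
  qed
  moreover have "max_cells (card (insert i I)) ?D = max_cells (card I) ?D + max_cells (card I) (dim ?W)"
    using insert dimW max_cells_Suc_Suc[of "card I" "dim ?W"] by simp
  ultimately show ?case
    by simp
qed

section \<open>Generic arrangements with prescribed pencils\<close>

text \<open>Induction on the number of subspaces: if \<open>x\<close> avoids the older ones but lies
  in the new \<open>U\<close>, and \<open>y\<close> lies outside \<open>U\<close>, then the line
  \<open>y + t *\<^sub>R x\<close> misses \<open>U\<close> and meets each older subspace at most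
  once.\<close>

lemma subspace_avoid_finite_Union:
  fixes S :: "'a::real_vector set"
  assumes "finite \<T>" "subspace S" "\<And>T. T \<in> \<T> \<Longrightarrow> subspace T" "\<And>T. T \<in> \<T> \<Longrightarrow> \<not> S \<subseteq> T"
  shows "\<exists>x\<in>S. x \<notin> \<Union>\<T>"
  using assms(1,3,4)
proof (induction \<T> rule: finite_induct)
  case empty
  then show ?case using subspace_0[OF assms(2)] by blast
next
  case (insert U \<T>)
  then obtain x where x: "x \<in> S" "x \<notin> \<Union>\<T>" by auto
  obtain y where y: "y \<in> S" "y \<notin> U" using insert.prems(2)[of U] by auto
  show ?case
  proof (cases "x \<in> U")
    case False
    then show ?thesis using x by blast
  next
    case True
    have "finite {t. y + t *\<^sub>R x \<in> T}" if T: "T \<in> \<T>" for T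
    proof -
      have "t = u" if "y + t *\<^sub>R x \<in> T" "y + u *\<^sub>R x \<in> T" for t u
      proof (rule ccontr)
        assume "t \<noteq> u"
        have "(y + t *\<^sub>R x) - (y + u *\<^sub>R x) \<in> T"
          using T that insert.prems(1) by (intro subspace_diff) auto
        then have "(t - u) *\<^sub>R x \<in> T"
          by (simp add: scaleR_diff_left)
        then have "(1 / (t - u)) *\<^sub>R ((t - u) *\<^sub>R x) \<in> T"
          using T insert.prems(1) by (metis insertCI subspace_mul)
        then show False
          using \<open>t \<noteq> u\<close> x(2) T by auto
      qed
      then have "is_singleton {t. y + t *\<^sub>R x \<in> T} \<or> {t. y + t *\<^sub>R x \<in> T} = {}"
        unfolding is_singleton_def by blast
      then show ?thesis
        by (auto simp: is_singleton_def)
    qed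
    then have "finite (\<Union>T\<in>\<T>. {t. y + t *\<^sub>R x \<in> T})"
      using insert.hyps by blast
    then obtain t where t: "t \<notin> (\<Union>T\<in>\<T>. {t. y + t *\<^sub>R x \<in> T})"
      using ex_new_if_finite infinite_UNIV_char_0 by blast
    have "y + t *\<^sub>R x \<notin> U"
    proof
      assume "y + t *\<^sub>R x \<in> U"
      then have "(y + t *\<^sub>R x) - t *\<^sub>R x \<in> U"
        using True insert.prems(1) by (intro subspace_diff subspace_mul) auto
      then show False using y by simp
    qed
    moreover have "y + t *\<^sub>R x \<in> S"
      using x y assms(2) by (intro subspace_add subspace_mul)
    ultimately show ?thesis
      using t by auto
  qed
qed

lemma orthogonal_to_hyperplane:
  fixes p z :: "'a::real_inner"
  assumes "p \<noteq> 0" "\<And>x. p \<bullet> x = 0 \<Longrightarrow> x \<bullet> z = 0"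
  shows "\<exists>t. z = t *\<^sub>R p"
proof -
  define y where "y = z - ((p \<bullet> z) / (p \<bullet> p)) *\<^sub>R p"
  have "p \<bullet> y = 0"
    using assms(1) by (simp add: y_def inner_diff_right)
  moreover from this have "y \<bullet> z = 0" by (rule assms(2))
  ultimately have "y \<bullet> y = 0"
    by (subst (2) y_def) (simp add: inner_diff_right inner_commute)
  then show ?thesis
    by (auto simp: y_def)
qed

text \<open>The normals are chosen one after another, each orthogonal to the point of its colour and
  off finitely many subspaces, none of which contains all such vectors.\<close>

lemma exists_pencil_generic:
  fixes p :: "'c \<Rightarrow> 'a::euclidean_space" and c :: "'i \<Rightarrow> 'c"
  assumes "finite I" "finite C" "c ` I \<subseteq> C" "\<And>k. p k \<noteq> 0"
    and indep: "\<And>k l t. k \<noteq> l \<Longrightarrow> p k \<noteq> t *\<^sub>R p l"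
  shows "\<exists>v. pencil_generic v p c I"
proof -
  let ?D = "DIM('a)"
  \<comment> \<open>The stronger claim, that each hyperplane misses the points of all other colours,
    is what rules out accidental dependencies.\<close>
  have "\<exists>v. pencil_generic v p c I \<and> (\<forall>i\<in>I. \<forall>k\<in>C. k \<noteq> c i \<longrightarrow> v i \<bullet> p k \<noteq> 0)"
    using assms(1,3)
  proof (induction I rule: finite_induct)
    case empty
    then show ?case by (auto simp: pencil_generic_def)
  next
    case (insert i I)
    then obtain v where v: "pencil_generic v p c I" "\<And>i k. i \<in> I \<Longrightarrow> k \<in> C \<Longrightarrow> k \<noteq> c i \<Longrightarrow> v i \<bullet> p k \<noteq> 0"
      by auto
    let ?H = "{x. p (c i) \<bullet> x = 0}"
    \<comment> \<open>\<open>\<J>\<close> holds the earlier families that must stay independent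
      after adding \<open>i\<close>; \<open>bad J\<close> is the orthogonal complement of their
      common kernel, that is, the span of their normals.\<close>
    define \<J> where "\<J> = {J. J \<subseteq> I \<and> card J < ?D \<and> (Suc (card J) < ?D \<or> (\<exists>j\<in>J. c j \<noteq> c i))}"
    define bad where "bad J = {x. \<forall>z\<in>common_kernel v J. x \<bullet> z = 0}" for J
    define \<T> where "\<T> = (\<lambda>k. {x. p k \<bullet> x = 0}) ` (C - {c i}) \<union> bad ` \<J>"
    have "\<exists>x\<in>?H. x \<notin> \<Union>\<T>"
    proof (rule subspace_avoid_finite_Union)
      have "\<J> \<subseteq> Pow I"
        by (auto simp: \<J>_def)
      then have "finite \<J>"
        using insert.hyps by (meson finite_Pow_iff finite_subset)
      then show "finite \<T>"
        using assms(2) by (simp add: \<T>_def)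
      show "subspace ?H" by (rule subspace_hyperplane)
      show "subspace T" if "T \<in> \<T>" for T
        using that unfolding \<T>_def bad_def
        by (auto simp: subspace_hyperplane) (auto simp: subspace_def inner_add_left)
      show "\<not> ?H \<subseteq> T" if "T \<in> \<T>" for T
      proof
        assume sub: "?H \<subseteq> T"
        from that consider k where "k \<in> C" "k \<noteq> c i" "T = {x. p k \<bullet> x = 0}"
          | J where "J \<in> \<J>" "T = bad J"
          unfolding \<T>_def by blast
        then show False
        proof cases
          case 1
          then have "\<exists>t. p k = t *\<^sub>R p (c i)"
            using sub by (intro orthogonal_to_hyperplane assms(4)) (auto simp: inner_commute)
          then show False using indep[OF 1(2)] by blast
        next
          case 2
          then have J: "J \<subseteq> I" "card J < ?D" "Suc (card J) < ?D \<or> (\<exists>j\<in>J. c j \<noteq> c i)"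
            by (auto simp: \<J>_def)
          have dim: "dim (common_kernel v J) + card J = ?D"
            using v(1) J unfolding pencil_generic_def by auto
          \<comment> \<open>If every vector orthogonal to \<open>p (c i)\<close> were bad, the
            kernel of \<open>J\<close> would lie on the line through \<open>p (c i)\<close>. Then
            \<open>J\<close> has \<open>?D - 1\<close> members, one of another colour, and its
            hyperplane would contain \<open>p (c i)\<close>.\<close>
          have mult: "\<exists>t. z = t *\<^sub>R p (c i)" if "z \<in> common_kernel v J" for z
            using that sub 2 by (intro orthogonal_to_hyperplane assms(4)) (auto simp: bad_def)
          then have "common_kernel v J \<subseteq> span {p (c i)}"
            by (auto simp: span_singleton)
          then have "dim (common_kernel v J) \<le> 1"
            using dim_subset[of _ "span {p (c i)}"] assms(4) by fastforce
          then have "\<not> Suc (card J) < ?D"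
            using dim by linarith
          then obtain j where j: "j \<in> J" "c j \<noteq> c i"
            using J(3) by blast
          have "dim (common_kernel v J) \<noteq> 0"
            using dim J(2) by linarith
          then obtain z where z: "z \<in> common_kernel v J" "z \<noteq> 0"
            by auto
          then obtain t where t: "z = t *\<^sub>R p (c i)" using mult by blast
          have "v j \<bullet> z = 0"
            using z j by (auto simp: common_kernel_def)
          moreover have "v j \<bullet> p (c i) \<noteq> 0"
            using v(2)[of j "c i"] j J insert.prems by auto
          ultimately show False
            using t z(2) by auto
        qed
      qed
    qed
    then obtain x where x: "x \<in> ?H" "x \<notin> \<Union>\<T>" by blast
    define w where "w = v(i := x)"
    have kernel_w: "common_kernel w J = common_kernel v J" if "i \<notin> J" for J
      using that by (auto simp: common_kernel_def w_def)
    have "pencil_generic w p c (insert i I)"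
      unfolding pencil_generic_def
    proof (intro conjI ballI allI impI)
      fix j assume "j \<in> insert i I"
      then show "w j \<bullet> p (c j) = 0"
        using v(1) x by (auto simp: w_def pencil_generic_def inner_commute)
    next
      fix J assume J: "J \<subseteq> insert i I" "card J \<le> ?D" "card J < ?D \<or> (\<nexists>k. \<forall>i\<in>J. c i = k)"
      show "dim (common_kernel w J) + card J = ?D"
      proof (cases "i \<in> J")
        case False
        then show ?thesis
          using J v(1) by (auto simp: kernel_w pencil_generic_def)
      next
        case True
        define L where "L = J - {i}"
        have "finite L" and L: "L \<subseteq> I" "i \<notin> L" "J = insert i L"
          using True J insert.hyps finite_subset[of J "insert i I"] by (auto simp: L_def)
        then have card: "card J = Suc (card L)" by simp
        then have "L \<in> \<J>"
          using L J unfolding \<J>_def by auto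
        then have "x \<notin> bad L"
          using x by (auto simp: \<T>_def)
        then obtain z where z: "z \<in> common_kernel v L" "x \<bullet> z \<noteq> 0"
          by (auto simp: bad_def)
        have "dim (common_kernel v L) = Suc (dim ({y. x \<bullet> y = 0} \<inter> common_kernel v L))"
          using z by (intro dim_hyperplane_Int subspace_common_kernel)
        moreover have "common_kernel w J = {y. x \<bullet> y = 0} \<inter> common_kernel v L"
          unfolding L(3) common_kernel_insert kernel_w[OF L(2)] by (simp add: w_def)
        moreover have "dim (common_kernel v L) + card L = ?D"
          using v(1) L card J unfolding pencil_generic_def by auto
        ultimately show ?thesis
          using card by simp
      qed
    qed
    moreover have "\<forall>j\<in>insert i I. \<forall>k\<in>C. k \<noteq> c j \<longrightarrow> w j \<bullet> p k \<noteq> 0"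
      using x v(2) insert.hyps by (auto simp: w_def \<T>_def inner_commute)
    ultimately show ?case by blast
  qed
  then show ?thesis by blast
qed

text \<open>Points on an affine line off the origin: the coordinate at \<open>a\<close> forces the
  factor \<open>t = 1\<close>, and the one at \<open>b\<close> then separates them.\<close>

lemma exists_pairwise_independent:
  assumes "DIM('a) \<ge> 2"
  obtains p :: "nat \<Rightarrow> 'a::euclidean_space" where "\<And>k. p k \<noteq> 0" "\<And>k l t. k \<noteq> l \<Longrightarrow> p k \<noteq> t *\<^sub>R p l"
proof -
  obtain a b :: 'a where ab: "a \<in> Basis" "b \<in> Basis" "a \<noteq> b"
    using assms card_le_Suc0_iff_eq[of "Basis :: 'a set"] by force
  define p where "p k = a + real k *\<^sub>R b" for k :: nat
  have a: "p k \<bullet> a = 1" and b: "p k \<bullet> b = real k" for k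
    using ab by (simp_all add: p_def inner_add_left inner_Basis)
  show ?thesis
  proof
    show "p k \<noteq> 0" for k
      using a[of k] by auto
    show "p k \<noteq> t *\<^sub>R p l" if "k \<noteq> l" for k l t
    proof
      assume eq: "p k = t *\<^sub>R p l"
      then have "t = 1"
        using a[of k] a[of l] by simp
      then show False
        using b[of k] b[of l] eq that by simp
    qed
  qed
qed

section \<open>Regions in projective space\<close>

text \<open>Each member and the union of the others are disjoint open sets, so a connected subset of
  the union containing a member cannot be larger.\<close>

lemma components_Union_open:
  fixes \<F> :: "'a::topological_space set set"
  assumes "\<And>S. S \<in> \<F> \<Longrightarrow> open S \<and> connected S \<and> S \<noteq> {}" "pairwise disjnt \<F>"
  shows "components (\<Union>\<F>) = \<F>"
proof -
  have comp: "S \<in> components (\<Union>\<F>)" if S: "S \<in> \<F>" for S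
    unfolding in_components_maximal
  proof (intro conjI allI impI)
    fix T assume T: "T \<noteq> {} \<and> S \<subseteq> T \<and> T \<subseteq> \<Union>\<F> \<and> connected T"
    have "open S" "open (\<Union>(\<F> - {S}))"
      using assms(1) S by auto
    moreover have "S \<inter> \<Union>(\<F> - {S}) = {}"
      using assms(2) S by (auto simp: pairwise_def disjnt_def)
    ultimately have "S \<inter> T = {} \<or> \<Union>(\<F> - {S}) \<inter> T = {}"
      using T S by (intro connectedD) auto
    moreover have "S \<inter> T \<noteq> {}"
      using assms(1)[OF S] T by auto
    ultimately have "\<Union>(\<F> - {S}) \<inter> T = {}" by blast
    then show "T = S"
      using T by blast
  qed (use assms(1) S in auto)
  moreover have "S \<in> \<F>" if S: "S \<in> components (\<Union>\<F>)" for S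
  proof -
    obtain x where "x \<in> S"
      using in_components_nonempty[OF S] by auto
    then obtain T where T: "T \<in> \<F>" "x \<in> T"
      using in_components_subset[OF S] by auto
    then have "S = T"
      using components_eq[OF S comp[OF T(1)]] \<open>x \<in> S\<close> by auto
    then show ?thesis using T by simp
  qed
  ultimately show ?thesis by blast
qed

section \<open>Homogeneous coordinates for points and hyperplanes\<close>

lemma line_of_rproj_class:
  assumes "x \<noteq> 0"
  shows "line_of (rproj_class x) = span {x}"
  unfolding rproj_class_def
  by (rule Abs_rproj_inverse) (use assms in \<open>auto simp: dim_singleton\<close>)

lemma rproj_class_cases:
  obtains x where "x \<noteq> 0" "q = rproj_class x"
proof -
  have q: "subspace (line_of q)" "dim (line_of q) = 1"
    using line_of[of q] by auto
  then obtain x where x: "x \<in> line_of q" "x \<noteq> 0"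
    by (metis dim_eq_0 subsetI singletonI zero_neq_one)
  then have "span {x} = line_of q"
    using q by (intro subspace_dim_equal) (auto intro: span_minimal[THEN subsetD])
  then have "q = rproj_class x"
    unfolding rproj_class_def by (metis line_of_inverse)
  then show ?thesis using x that by blast
qed

lemma rproj_class_eq_iff:
  assumes "x \<noteq> 0" "y \<noteq> 0"
  shows "rproj_class x = rproj_class y \<longleftrightarrow> (\<exists>t. t \<noteq> 0 \<and> x = t *\<^sub>R y)"
proof
  assume "rproj_class x = rproj_class y"
  then have "span {x} = span {y}"
    using assms by (metis line_of_rproj_class)
  then have "x \<in> span {y}"
    by (metis insertI1 span_base)
  then show "\<exists>t. t \<noteq> 0 \<and> x = t *\<^sub>R y"
    using assms by (auto simp: span_singleton)
next
  assume "\<exists>t. t \<noteq> 0 \<and> x = t *\<^sub>R y"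
  then obtain t where "t \<noteq> 0" "x = t *\<^sub>R y" by blast
  moreover from this have "y = (1 / t) *\<^sub>R x" by simp
  ultimately have "x \<in> span {y}" "y \<in> span {x}"
    by (metis insertI1 span_base span_mul)+
  then have "span {x} = span {y}"
    by (intro equalityI span_minimal) auto
  then show "rproj_class x = rproj_class y"
    by (simp add: rproj_class_def)
qed

definition normal_hyperplane :: "'a::euclidean_space \<Rightarrow> 'a rproj set" where
  "normal_hyperplane a = {q. line_of q \<subseteq> {x. a \<bullet> x = 0}}"

lemma rproj_class_in_normal_hyperplane:
  assumes "x \<noteq> 0"
  shows "rproj_class x \<in> normal_hyperplane a \<longleftrightarrow> a \<bullet> x = 0"
proof -
  have "span {x} \<subseteq> {x. a \<bullet> x = 0} \<longleftrightarrow> {x} \<subseteq> {x. a \<bullet> x = 0}"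
  proof
    show "{x} \<subseteq> {x. a \<bullet> x = 0}" if "span {x} \<subseteq> {x. a \<bullet> x = 0}"
      using span_superset that by (rule subset_trans)
  qed (intro span_minimal subspace_hyperplane)
  then show ?thesis
    using assms by (simp add: normal_hyperplane_def line_of_rproj_class)
qed

lemma rproj_hyperplane_normal: "a \<noteq> 0 \<Longrightarrow> rproj_hyperplane (normal_hyperplane a)"
  unfolding rproj_hyperplane_def normal_hyperplane_def
  by (intro exI[of _ "{x. a \<bullet> x = 0}"]) (simp add: subspace_hyperplane dim_hyperplane)

lemma rproj_hyperplane_cases:
  fixes H :: "'a::euclidean_space rproj set"
  assumes "rproj_hyperplane H"
  obtains a where "a \<noteq> 0" "H = normal_hyperplane a"
proof -
  obtain W :: "'a set" where W: "subspace W" "dim W + 1 = DIM('a)" "H = {q. line_of q \<subseteq> W}"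
    using assms by (auto simp: rproj_hyperplane_def)
  then have "dim W = DIM('a) - 1" by simp
  then obtain a where "a \<noteq> 0" "span W = {x. a \<bullet> x = 0}"
    using lowdim_eq_hyperplane by metis
  then show ?thesis
    using W that by (metis normal_hyperplane_def span_eq_iff)
qed

section \<open>Projective regions as antipodal pairs of cells\<close>

lemma zero_notin_sign_cell: "i \<in> I \<Longrightarrow> 0 \<notin> sign_cell v I s"
  by (auto simp: sign_cell_def intro!: bexI[of _ i])

lemma sign_cell_complement:
  assumes "s \<subseteq> I"
  shows "x \<in> sign_cell v I (I - s) \<longleftrightarrow> - x \<in> sign_cell v I s"
  using assms unfolding sign_cell_def by auto

text \<open>Representatives of a point differ by a nonzero factor, and a negative one flips all
  signs. The preimage of a projected cell is thus the cell with its antipode, which will make the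
  projected cell open.\<close>

lemma rproj_class_in_image_sign_cell:
  assumes "i \<in> I" "s \<subseteq> I" "x \<noteq> 0"
  shows "rproj_class x \<in> rproj_class ` sign_cell v I s \<longleftrightarrow> x \<in> sign_cell v I s \<union> sign_cell v I (I - s)"
proof
  assume "rproj_class x \<in> rproj_class ` sign_cell v I s"
  then obtain y where y: "y \<in> sign_cell v I s" "rproj_class x = rproj_class y" by blast
  have "y \<noteq> 0"
    using y(1) zero_notin_sign_cell[OF assms(1)] by blast
  then obtain t where t: "t \<noteq> 0" "x = t *\<^sub>R y"
    using y(2) rproj_class_eq_iff assms(3) by blast
  show "x \<in> sign_cell v I s \<union> sign_cell v I (I - s)"
  proof (cases "t > 0")
    case True
    then have "x \<in> sign_cell v I s"
      using sign_cell_pos_combination[OF y(1) y(1), of t 0] t by simp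
    then show ?thesis by blast
  next
    case False
    then have "- x \<in> sign_cell v I s"
      using sign_cell_pos_combination[OF y(1) y(1), of "- t" 0] t by simp
    then show ?thesis using sign_cell_complement[OF assms(2)] by blast
  qed
next
  assume "x \<in> sign_cell v I s \<union> sign_cell v I (I - s)"
  then have "x \<in> sign_cell v I s \<or> - x \<in> sign_cell v I s"
    using sign_cell_complement[OF assms(2)] by blast
  moreover have "rproj_class (- x) = rproj_class x"
    using assms(3) by (subst rproj_class_eq_iff) (auto intro!: exI[of _ "-1"])
  ultimately show "rproj_class x \<in> rproj_class ` sign_cell v I s"
    by (metis image_eqI)
qed

text \<open>Projection identifies exactly the antipodal cells. The index \<open>i\<close> makes
  \<open>I\<close> nonempty: with no hyperplanes the whole space is a single cell, its own
  antipode.\<close>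

lemma two_num_regions:
  fixes v :: "'i \<Rightarrow> 'a::euclidean_space"
  assumes "finite I" "i \<in> I"
  shows "2 * num_regions ((\<lambda>i. normal_hyperplane (v i)) ` I) = card (sign_sets v I UNIV)"
proof -
  let ?R = "sign_sets v I UNIV"
  let ?f = "\<lambda>s. rproj_class ` sign_cell v I s"
  let ?X = "- \<Union>((\<lambda>i. normal_hyperplane (v i)) ` I)"
  have nz: "x \<noteq> 0" if "x \<in> sign_cell v I s" for x s
    using that zero_notin_sign_cell[OF assms(2)] by blast
  have R: "s \<subseteq> I" "sign_cell v I s \<noteq> {}" if "s \<in> ?R" for s
    using that by (auto simp: sign_sets_def)
  have meet: "t = s \<or> t = I - s" if st: "s \<in> ?R" "t \<in> ?R" "q \<in> ?f s" "q \<in> ?f t" for s t q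
  proof -
    obtain x where x: "x \<in> sign_cell v I t" "q = rproj_class x"
      using st(4) by blast
    then have "x \<in> sign_cell v I s \<union> sign_cell v I (I - s)"
      using st(3) rproj_class_in_image_sign_cell[OF assms(2) R(1)[OF st(1)] nz[OF x(1)]] by simp
    then show ?thesis
      using sign_cell_unique[OF x(1)] R(1) st(1,2) by blast
  qed
  have compl: "I - s \<in> ?R" "?f (I - s) = ?f s" if s: "s \<in> ?R" for s
  proof -
    have sub: "s \<subseteq> I" "I - (I - s) = s"
      using R(1)[OF s] by auto
    obtain x where "x \<in> sign_cell v I s" using R(2)[OF s] by blast
    then have "- x \<in> sign_cell v I (I - s)"
      using sign_cell_complement[OF sub(1), of "- x" v] by simp
    then show "I - s \<in> ?R" by (auto simp: sign_sets_def)
    have "?f t \<subseteq> ?f (I - t)" if "t \<subseteq> I" "I - (I - t) = t" for t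
    proof (rule image_subsetI)
      fix x assume x: "x \<in> sign_cell v I t"
      then show "rproj_class x \<in> ?f (I - t)"
        using rproj_class_in_image_sign_cell[OF assms(2) _ nz[OF x], of "I - t" v] that by simp
    qed
    then show "?f (I - s) = ?f s"
      using sub by (metis Diff_subset subset_antisym)
  qed
  \<comment> \<open>The projected cells are open, connected as images of convex sets, and pairwise
    disjoint, hence the components of their union.\<close>
  have comp: "components (\<Union>(?f ` ?R)) = ?f ` ?R"
  proof (rule components_Union_open)
    fix S assume "S \<in> ?f ` ?R"
    then obtain s where s: "s \<in> ?R" "S = ?f s" by blast
    have "{x. x \<noteq> 0 \<and> rproj_class x \<in> S} = sign_cell v I s \<union> sign_cell v I (I - s)"
      using rproj_class_in_image_sign_cell[OF assms(2) R(1)[OF s(1)]] nz s(2) by blast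
    then have "open S"
      unfolding open_rproj_def using open_sign_cell[OF assms(1)] by auto
    moreover have "connected S"
      unfolding s(2)
    proof (rule connected_continuous_image)
      have "rproj_class -` B \<inter> sign_cell v I s = {x. x \<noteq> 0 \<and> rproj_class x \<in> B} \<inter> sign_cell v I s" for B
        using nz by blast
      then show "continuous_on (sign_cell v I s) rproj_class"
        using open_sign_cell[OF assms(1), of v s]
        by (subst continuous_on_open_vimage) (auto simp: open_rproj_def)
      have "convex (sign_cell v I s)"
        unfolding convex_def by (auto intro!: sign_cell_pos_combination)
      then show "connected (sign_cell v I s)" by (rule convex_connected)
    qed
    moreover have "S \<noteq> {}" using R(2)[OF s(1)] s(2) by blast
    ultimately show "open S \<and> connected S \<and> S \<noteq> {}" by blast
  next
    show "pairwise disjnt (?f ` ?R)"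
      unfolding pairwise_def disjnt_def using meet compl(2) by blast
  qed
  have "\<Union>(?f ` ?R) = ?X"
  proof (intro set_eqI iffI)
    fix q assume "q \<in> \<Union>(?f ` ?R)"
    then obtain s x where x: "x \<in> sign_cell v I s" "q = rproj_class x" by blast
    then have "\<forall>i\<in>I. v i \<bullet> x \<noteq> 0"
      by (auto simp: sign_cell_def split: if_splits)
    then show "q \<in> ?X"
      using x nz[OF x(1)] by (simp add: rproj_class_in_normal_hyperplane)
  next
    fix q assume q: "q \<in> ?X"
    obtain x where x: "x \<noteq> 0" "q = rproj_class x" by (rule rproj_class_cases)
    then have "\<forall>i\<in>I. v i \<bullet> x \<noteq> 0"
      using q by (simp add: rproj_class_in_normal_hyperplane)
    then have "x \<in> sign_cell v I {i\<in>I. v i \<bullet> x > 0}"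
      by (auto simp: sign_cell_def)
    moreover from this have "{i\<in>I. v i \<bullet> x > 0} \<in> ?R"
      by (auto simp: sign_sets_def)
    ultimately show "q \<in> \<Union>(?f ` ?R)"
      using x(2) by blast
  qed
  then have num: "num_regions ((\<lambda>i. normal_hyperplane (v i)) ` I) = card (?f ` ?R)"
    unfolding num_regions_def using comp by simp
  \<comment> \<open>Exactly one cell of each antipodal pair is on the positive side of hyperplane
    \<open>i\<close>, so \<open>P\<close> is a system of representatives.\<close>
  define P where "P = {s \<in> ?R. i \<in> s}"
  have finP: "finite P"
    unfolding P_def using finite_sign_sets[OF assms(1), of v UNIV] by simp
  have split: "?R = P \<union> (\<lambda>s. I - s) ` P"
  proof (intro equalityI subsetI)
    fix s assume s: "s \<in> ?R"
    then have "I - (I - s) = s" using R(1) by blast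
    then show "s \<in> P \<union> (\<lambda>s. I - s) ` P"
      using s compl(1)[OF s] assms(2) unfolding P_def by (cases "i \<in> s") (auto intro!: image_eqI[of s _ "I - s"])
  qed (auto simp: P_def compl(1))
  have "inj_on (\<lambda>s. I - s) P"
    unfolding P_def by (rule inj_onI) (metis (no_types, lifting) Diff_Diff_Int Int_absorb1 R(1) mem_Collect_eq)
  moreover have "P \<inter> (\<lambda>s. I - s) ` P = {}"
    by (auto simp: P_def)
  ultimately have "card ?R = 2 * card P"
    using finP by (subst split) (simp add: card_Un_disjoint card_image)
  moreover have "?f ` ?R = ?f ` P"
    by (subst split) (use compl(2) in \<open>auto simp: P_def image_Un image_image\<close>)
  moreover have "inj_on ?f P"
  proof (rule inj_onI)
    fix s t assume st: "s \<in> P" "t \<in> P" "?f s = ?f t"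
    then have "s \<in> ?R" "t \<in> ?R" "i \<in> s" "i \<in> t" by (auto simp: P_def)
    moreover obtain q where "q \<in> ?f s" using R(2)[OF \<open>s \<in> ?R\<close>] by blast
    ultimately show "s = t" using meet[of s t q] st(3) by blast
  qed
  ultimately show ?thesis
    using num by (simp add: card_image)
qed

section \<open>Sparse sums of binomial coefficients\<close>

text \<open>An entry \<open>x\<close> stands for a pencil of \<open>x + 1\<close> hyperplanes, which
  loses \<open>x choose d\<close> regions; \<open>S\<close> is the number of hyperplanes
  available.\<close>

definition binomial_rep :: "nat \<Rightarrow> nat \<Rightarrow> nat \<Rightarrow> bool" where
  "binomial_rep d N S \<longleftrightarrow> (\<exists>xs. (\<Sum>x\<leftarrow>xs. x choose d) = N \<and> (\<Sum>x\<leftarrow>xs. Suc x) \<le> S)"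

lemma binomial_rep_mono: "binomial_rep d N S \<Longrightarrow> S \<le> T \<Longrightarrow> binomial_rep d N T"
  unfolding binomial_rep_def using le_trans by blast

lemma binomial_rep_Cons:
  assumes "binomial_rep d N S"
  shows "binomial_rep d ((x choose d) + N) (Suc x + S)"
proof -
  obtain xs where "(\<Sum>x\<leftarrow>xs. x choose d) = N" "(\<Sum>x\<leftarrow>xs. Suc x) \<le> S"
    using assms unfolding binomial_rep_def by blast
  then show ?thesis
    unfolding binomial_rep_def by (intro exI[of _ "x # xs"]) simp
qed

lemma binomial_rep_0: "binomial_rep d 0 S"
  unfolding binomial_rep_def by (intro exI[of _ "[]"]) simp

lemma binomial_rep_replicate: "binomial_rep d N (N * Suc d)"
  unfolding binomial_rep_def by (intro exI[of _ "replicate N d"]) (simp add: sum_list_replicate)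

text \<open>The left side is at most \<open>x ^ (d - 1)\<close>, the right side at least
  \<open>(x / (2 * d)) ^ d\<close> because its upper index is at least \<open>x / 2\<close>. Beyond
  the threshold the second bound dominates.\<close>

lemma choose_half_dominates:
  assumes "d \<ge> 1" "x \<ge> (2 * d) ^ d"
  shows "x choose (d - 1) \<le> Suc ((x - 1) div 2) choose d"
proof -
  let ?z = "Suc ((x - 1) div 2)"
  have z: "x \<le> 2 * ?z" by simp
  have "(2 * d) ^ 1 \<le> (2 * d) ^ d"
    using assms(1) by (intro power_increasing) auto
  then have x: "2 * d \<le> x" using assms(2) by simp
  then have "d \<le> ?z" using z by linarith
  have "real (x choose (d - 1)) \<le> real (x ^ (d - 1))"
    using x by (intro of_nat_mono binomial_le_pow) auto
  also have "\<dots> \<le> (real ?z / real d) ^ d"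
  proof -
    have "real ((2 * d) ^ d) * real (x ^ (d - 1)) \<le> real x * real (x ^ (d - 1))"
      using assms(2) by (intro mult_right_mono of_nat_mono) auto
    also have "\<dots> = real x ^ d"
      using assms(1) by (cases d) auto
    also have "\<dots> \<le> real (2 * ?z) ^ d"
      using z by (intro power_mono of_nat_mono) auto
    also have "real (2 * ?z) = real (2 * d) * (real ?z / real d)"
      using assms(1) by simp
    also have "\<dots> ^ d = real ((2 * d) ^ d) * (real ?z / real d) ^ d"
      by (simp only: power_mult_distrib[of _ "real ?z / real d"] of_nat_power)
    finally show ?thesis
      using assms(1) by (subst (asm) mult_le_cancel_left_pos) simp_all
  qed
  also have "\<dots> \<le> real (?z choose d)"
    using \<open>d \<le> ?z\<close> by (rule binomial_ge_n_over_k_pow_k)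
  finally show ?thesis by simp
qed

text \<open>Greedy step: once the largest \<open>x choose d\<close> has been removed the remainder is below
  \<open>x choose (d - 1)\<close>, whose own leading term is less than half of \<open>x\<close> when \<open>x\<close> is large.\<close>

lemma binomial_rep_linear:
  assumes "d \<ge> 1"
  shows "\<exists>C. \<forall>x N. N < Suc x choose d \<longrightarrow> binomial_rep d N (2 * x + C)"
proof -
  \<comment> \<open>\<open>x0\<close> is the threshold of \<open>choose_half_dominates\<close>.
    Below it \<open>N\<close> is written as \<open>N\<close> copies of \<open>d choose d\<close>,
    and \<open>C\<close> pays for the worst such case.\<close>
  define x0 where "x0 = (2 * d) ^ d"
  define C where "C = (x0 choose d) * Suc d"
  have "binomial_rep d N (2 * x + C)" if "N < Suc x choose d" for x N
    using that
  proof (induction x arbitrary: N rule: less_induct)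
    case (less x)
    show ?case
    proof (cases "x < x0")
      case True
      then have "Suc x choose d \<le> x0 choose d"
        by (intro binomial_right_mono) auto
      then have "N * Suc d \<le> C"
        unfolding C_def using less.prems by (intro mult_right_mono) auto
      then show ?thesis
        using binomial_rep_mono[OF binomial_rep_replicate] by fastforce
    next
      case False
      have "x0 \<ge> 1" using assms by (simp add: x0_def)
      then have x: "x \<ge> 1" using False by simp
      show ?thesis
      proof (cases "N < x choose d")
        case True
        then have "binomial_rep d N (2 * (x - 1) + C)"
          using x by (intro less.IH) auto
        then show ?thesis by (rule binomial_rep_mono) simp
      next
        case ge: False
        \<comment> \<open>Since \<open>2 * ?y \<le> x - 1\<close>, the term \<open>x\<close> with
          its cost \<open>Suc x\<close> and the remainder fit into \<open>2 * x + C\<close>.\<close>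
        let ?y = "(x - 1) div 2"
        have "N - (x choose d) < x choose (d - 1)"
          using less.prems ge assms by (cases d) auto
        also have "\<dots> \<le> Suc ?y choose d"
          using False assms by (intro choose_half_dominates) (auto simp: x0_def)
        finally have "binomial_rep d (N - (x choose d)) (2 * ?y + C)"
          using x by (intro less.IH) auto
        from binomial_rep_Cons[OF this, of x]
        have "binomial_rep d N (Suc x + (2 * ?y + C))" using ge by simp
        then show ?thesis by (rule binomial_rep_mono) (use x in linarith)
      qed
    qed
  qed
  then show ?thesis by blast
qed

text \<open>Descending on \<open>m\<close> finds the leading term. The remainder is below
  \<open>m choose (d - 1)\<close>, so the linear bound applies to it with index \<open>y\<close>;
  keeping \<open>y\<close> apart from \<open>m\<close> later allows it to be of order
  \<open>n powr b\<close>.\<close>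

lemma binomial_rep_le_choose:
  assumes "d \<ge> 1" "\<And>x N. N < Suc x choose d \<Longrightarrow> binomial_rep d N (2 * x + C)"
    and "N \<le> m choose d" "m choose (d - 1) < Suc y choose d"
  shows "binomial_rep d N (Suc m + 2 * y + C)"
  using assms(3,4)
proof (induction m)
  case 0
  then show ?case using assms(1) binomial_rep_0 by (simp add: binomial_eq_0)
next
  case (Suc m)
  have "m choose (d - 1) \<le> Suc m choose (d - 1)"
    by (intro binomial_right_mono) auto
  then have y: "m choose (d - 1) < Suc y choose d"
    using Suc.prems by simp
  consider "N \<le> m choose d" | "N = Suc m choose d" | "m choose d < N" "N < Suc m choose d"
    using Suc.prems by linarith
  then show ?case
  proof cases
    case 1
    then show ?thesis
      using Suc.IH[OF _ y] by (auto elim: binomial_rep_mono)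
  next
    case 2
    then show ?thesis
      using binomial_rep_Cons[OF binomial_rep_0, of d "Suc m" 0] by (auto elim: binomial_rep_mono)
  next
    case 3
    then have "N - (m choose d) < m choose (d - 1)"
      using assms(1) by (cases d) auto
    then have "binomial_rep d (N - (m choose d)) (2 * y + C)"
      using y by (intro assms(2)) simp
    from binomial_rep_Cons[OF this, of m] show ?thesis
      using 3 by (auto elim: binomial_rep_mono)
  qed
qed

text \<open>The right side is the product of \<open>m + 1\<close> up to
  \<open>m + k\<close>.\<close>

lemma power_le_fact_times_choose: "Suc m ^ k \<le> fact k * ((m + k) choose k)"
proof (induction k)
  case (Suc k)
  have "Suc m ^ Suc k \<le> (m + Suc k) * (fact k * ((m + k) choose k))"
    using Suc by (simp add: mult_le_mono del: mult_Suc)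
  also have "\<dots> = fact k * (Suc (m + k) * ((m + k) choose k))"
    by (simp add: algebra_simps)
  also have "\<dots> = fact (Suc k) * ((m + Suc k) choose Suc k)"
    by (subst Suc_times_binomial[symmetric]) (simp add: algebra_simps)
  finally show ?case .
qed simp

text \<open>For \<open>r = n powr b\<close> one has \<open>r ^ d = n ^ (d - 1)\<close>, so the
  remainder after the leading term is below \<open>(2 * r) ^ d / fact d\<close> and needs an index
  of about \<open>2 * r\<close>. Its cost of about \<open>4 * r\<close> and a slack of
  \<open>r\<close> are covered by \<open>(d + 1) * r\<close> because
  \<open>d \<ge> 4\<close>.\<close>

lemma binomial_rep_asymptotic:
  assumes "d \<ge> 4" "b = (real d - 1) / real d"
  shows "\<forall>\<^sub>F n in sequentially.
    \<forall>N \<le> nat \<lfloor>real n - (real d + 1) * real n powr b\<rfloor> choose d. binomial_rep d N n"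
proof -
  have d: "d \<ge> 1" using assms by simp
  obtain C where C: "\<And>x N. N < Suc x choose d \<Longrightarrow> binomial_rep d N (2 * x + C)"
    using binomial_rep_linear[OF d] by blast
  have to_top: "filterlim (\<lambda>n. real n powr a) at_top sequentially" if "a > 0" for a
    using that by real_asymp
  \<comment> \<open>The slack \<open>r\<close> absorbs the constants: 1 from \<open>Suc m\<close>, 2
    from twice the ceiling, \<open>2 * d\<close> from the shift in \<open>y\<close>, and
    \<open>C\<close>.\<close>
  have ev1: "\<forall>\<^sub>F n in sequentially. real n powr b \<ge> 3 + 2 * real d + real C"
    using to_top[of b] assms by (simp add: filterlim_at_top)
  \<comment> \<open>As \<open>n = r * n powr (1 / d)\<close>, this makes
    \<open>n - (d + 1) * r\<close> nonnegative, so \<open>nat\<close> does not truncate in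
    \<open>m\<close>.\<close>
  have ev2: "\<forall>\<^sub>F n in sequentially. real n powr (1 / real d) \<ge> real d + 1"
    using to_top[of "1 / real d"] assms by (simp add: filterlim_at_top)
  show ?thesis
    using ev1 ev2 eventually_gt_at_top[of 0]
  proof eventually_elim
    case (elim n)
    define r where "r = real n powr b"
    define m where "m = nat \<lfloor>real n - (real d + 1) * r\<rfloor>"
    \<comment> \<open>The factor 2 comes from \<open>d \<le> 2 ^ d\<close>; the shift by
      \<open>d\<close> matches the upper index in \<open>power_le_fact_times_choose\<close>.\<close>
    define y where "y = nat \<lceil>2 * r\<rceil> + d"
    have "r \<ge> 0" by (simp add: r_def)
    have "r * (real d + 1) \<le> r * real n powr (1 / real d)"
      using elim \<open>r \<ge> 0\<close> by (intro mult_left_mono)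
    also have "\<dots> = real n powr (b + 1 / real d)"
      by (simp add: r_def powr_add)
    also have "b + 1 / real d = 1"
      using assms by (simp add: field_simps)
    finally have nonneg: "real n - (real d + 1) * r \<ge> 0"
      using elim by (simp add: mult.commute)
    then have m: "real m \<le> real n - (real d + 1) * r"
      unfolding m_def by linarith
    then have "m \<le> n"
      using \<open>r \<ge> 0\<close> by (smt (verit) mult_nonneg_nonneg of_nat_0_le_iff of_nat_le_iff)
    have r_pow: "r ^ d = real n ^ (d - 1)"
    proof -
      have "r ^ d = real n powr (real d * b)"
        using elim by (simp add: r_def powr_power)
      also have "real d * b = real (d - 1)"
        using assms by (simp add: of_nat_diff)
      finally show ?thesis
        using elim by (simp add: powr_realpow)
    qed
    have "m choose (d - 1) < Suc y choose d"
    proof -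
      let ?k = "nat \<lceil>2 * r\<rceil>"
      have "real (fact d * (m choose (d - 1))) = real d * real ((m choose (d - 1)) * fact (d - 1))"
        using d by (simp add: fact_reduce[of d])
      also have "\<dots> \<le> real d * real (m ^ (d - 1))"
        by (intro mult_left_mono of_nat_mono binomial_fact_pow) auto
      also have "\<dots> \<le> 2 ^ d * real n ^ (d - 1)"
      proof (intro mult_mono)
        show "real d \<le> 2 ^ d" using of_nat_less_two_power[of d] by simp
        show "real (m ^ (d - 1)) \<le> real n ^ (d - 1)"
          using \<open>m \<le> n\<close> by (simp add: power_mono)
      qed auto
      also have "\<dots> = (2 * r) ^ d"
        by (simp add: power_mult_distrib r_pow)
      also have "\<dots> < real (Suc (Suc ?k)) ^ d"
        using \<open>r \<ge> 0\<close> d by (intro power_strict_mono) linarith+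
      also have "\<dots> \<le> real (fact d * ((Suc ?k + d) choose d))"
        using power_le_fact_times_choose[of "Suc ?k" d] by (metis of_nat_le_iff of_nat_power)
      finally have "fact d * (m choose (d - 1)) < fact d * (Suc y choose d)"
        unfolding y_def by (simp only: of_nat_less_iff add_Suc)
      then show ?thesis by simp
    qed
    then have rep: "binomial_rep d N (Suc m + 2 * y + C)" if "N \<le> m choose d" for N
      using that by (intro binomial_rep_le_choose[OF d C])
    have "real (Suc m + 2 * y + C) \<le> real n - (real d + 1) * r + 4 * r + 3 + 2 * real d + real C"
      using m \<open>r \<ge> 0\<close> unfolding y_def by (simp add: algebra_simps) linarith
    also have "\<dots> \<le> real n - 5 * r + 4 * r + r"
    proof -
      have "5 * r \<le> (real d + 1) * r"
        using assms \<open>r \<ge> 0\<close> by (intro mult_right_mono) auto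
      then show ?thesis using elim(1) unfolding r_def by linarith
    qed
    finally have "Suc m + 2 * y + C \<le> n"
      by simp
    then show ?case
      using rep binomial_rep_mono unfolding m_def r_def by blast
  qed
qed

text \<open>Each entry \<open>x\<close> becomes a block of \<open>x + 1\<close> indices of one fresh
  colour. The indices left over get distinct colours, each contributing
  \<open>0 choose d = 0\<close> as \<open>d \<ge> 1\<close>.\<close>

lemma binomial_rep_colouring:
  assumes "binomial_rep d N n" "d \<ge> 1"
  obtains c :: "nat \<Rightarrow> nat" and C where "finite C" "c ` {..<n} \<subseteq> C"
    "(\<Sum>k\<in>C. (card {i\<in>{..<n}. c i = k} - 1) choose d) = N"
proof -
  have colouring: "\<exists>(c :: nat \<Rightarrow> nat) C. finite C \<and> c ` {..<n} \<subseteq> C \<and>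
      (\<Sum>k\<in>C. (card {i\<in>{..<n}. c i = k} - 1) choose d) = (\<Sum>x\<leftarrow>xs. x choose d)"
    if len: "(\<Sum>x\<leftarrow>xs. Suc x) \<le> n" for xs
    using len
  proof (induction xs arbitrary: n)
    case Nil
    have "{i\<in>{..<n}. id i = k} = {k}" if "k \<in> {..<n}" for k
      using that by auto
    then have "(\<Sum>k\<in>{..<n}. (card {i\<in>{..<n}. id i = k} - 1) choose d) = 0"
      using assms(2) by (simp add: binomial_eq_0)
    then show ?case
      by (intro exI[of _ id] exI[of _ "{..<n}"]) simp
  next
    case (Cons x xs)
    define l where "l = n - Suc x"
    have n: "n = l + Suc x" and l: "(\<Sum>x\<leftarrow>xs. Suc x) \<le> l"
      using Cons.prems by (auto simp: l_def)
    obtain c :: "nat \<Rightarrow> nat" and C where C: "finite C" "c ` {..<l} \<subseteq> C"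
      "(\<Sum>k\<in>C. (card {i\<in>{..<l}. c i = k} - 1) choose d) = (\<Sum>x\<leftarrow>xs. x choose d)"
      using Cons.IH[OF l] by blast
    obtain h where h: "h \<notin> C"
      using C(1) ex_new_if_finite infinite_UNIV_nat by blast
    define c' where "c' i = (if i < l then c i else h)" for i
    have new: "c i \<noteq> h" if "i < l" for i
      using h C(2) that by blast
    have old: "{i\<in>{..<n}. c' i = k} = {i\<in>{..<l}. c i = k}" if "k \<in> C" for k
      using h that n by (auto simp: c'_def)
    have "{i\<in>{..<n}. c' i = h} = {l..<n}"
      using new n by (auto simp: c'_def)
    then have "card {i\<in>{..<n}. c' i = h} = Suc x"
      using n by simp
    moreover have "(\<Sum>k\<in>C. (card {i\<in>{..<n}. c' i = k} - 1) choose d) = (\<Sum>x\<leftarrow>xs. x choose d)"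
      unfolding C(3)[symmetric] using old by (intro sum.cong) simp_all
    ultimately have "(\<Sum>k\<in>insert h C. (card {i\<in>{..<n}. c' i = k} - 1) choose d) =
        (\<Sum>x\<leftarrow>x # xs. x choose d)"
      using C(1) h by simp
    moreover have "c' ` {..<n} \<subseteq> insert h C"
      using C(2) by (auto simp: c'_def)
    ultimately show ?case
      using C(1) by blast
  qed
  obtain xs where xs: "(\<Sum>x\<leftarrow>xs. x choose d) = N" "(\<Sum>x\<leftarrow>xs. Suc x) \<le> n"
    using assms(1) unfolding binomial_rep_def by blast
  then show ?thesis
    using colouring[OF xs(2)] that unfolding xs(1) by blast
qed

section \<open>Prescribing the number of regions\<close>

lemma two_num_regions_le:
  fixes \<A> :: "'a::euclidean_space rproj set set"
  assumes "arrangement n \<A>" "n > 0"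
  shows "2 * num_regions \<A> \<le> max_cells n DIM('a)"
proof -
  have A: "finite \<A>" "card \<A> = n" "\<forall>H\<in>\<A>. rproj_hyperplane H"
    using assms(1) by (auto simp: arrangement_def)
  have "\<forall>H\<in>\<A>. \<exists>a. H = normal_hyperplane a"
    using A(3) rproj_hyperplane_cases by metis
  then obtain a where a: "\<forall>H\<in>\<A>. H = normal_hyperplane (a H)"
    using bchoice by metis
  then have image: "(\<lambda>H. normal_hyperplane (a H)) ` \<A> = \<A>"
    by force
  obtain H where "H \<in> \<A>"
    using A(2) assms(2) by fastforce
  \<comment> \<open>The hyperplanes serve as their own index set, with normals
    \<open>a\<close>.\<close>
  from two_num_regions[OF A(1) this, of a]
  have "2 * num_regions \<A> = card (sign_sets a \<A> UNIV)"
    unfolding image .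
  also have "\<dots> \<le> max_cells n DIM('a)"
    using card_sign_sets_le[OF A(1) subspace_UNIV, of a] A(2) by simp
  finally show ?thesis .
qed

text \<open>Families of fewer than \<open>DIM('a)\<close> normals are independent whatever their
  colours: one normal is thus nonzero, two give distinct hyperplanes, and the kernel of
  \<open>DIM('a) - 1\<close> of them is a line, that is, one projective point.\<close>

lemma exists_arrangement_of_colouring:
  fixes c :: "nat \<Rightarrow> nat"
  assumes D: "DIM('a::euclidean_space) \<ge> 3" and "n > 0" "finite C" "c ` {..<n} \<subseteq> C"
  shows "\<exists>\<A> :: 'a rproj set set. arrangement n \<A> \<and>
    2 * num_regions \<A> + 2 * (\<Sum>k\<in>C. (card {i\<in>{..<n}. c i = k} - 1) choose (DIM('a) - 1)) =
      max_cells n DIM('a) \<and>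
    (\<forall>\<B>\<subseteq>\<A>. card \<B> = DIM('a) - 1 \<longrightarrow> (\<exists>q. \<Inter>\<B> = {q}))"
proof -
  let ?D = "DIM('a)"
  let ?I = "{..<n}"
  have "?D \<ge> 2" using D by simp
  then obtain p :: "nat \<Rightarrow> 'a" where p: "\<And>k. p k \<noteq> 0" "\<And>k l t. k \<noteq> l \<Longrightarrow> p k \<noteq> t *\<^sub>R p l"
    by (rule exists_pairwise_independent) blast
  then obtain v where v: "pencil_generic v p c ?I"
    using exists_pencil_generic[OF finite_lessThan assms(3,4), of p] by blast
  have dim: "dim (common_kernel v J) + card J = ?D" if "J \<subseteq> ?I" "card J < ?D" for J
    using v that unfolding pencil_generic_def by auto
  let ?h = "\<lambda>i. normal_hyperplane (v i)"
  have nz: "v i \<noteq> 0" if "i \<in> ?I" for i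
    using dim[of "{i}"] that D by (auto simp: common_kernel_def)
  have inj: "inj_on ?h ?I"
  proof (rule inj_onI, rule ccontr)
    fix i j assume ij: "i \<in> ?I" "j \<in> ?I" "?h i = ?h j" "i \<noteq> j"
    have "v i \<bullet> x = 0 \<longleftrightarrow> v j \<bullet> x = 0" for x
      using ij(3) rproj_class_in_normal_hyperplane by (cases "x = 0") auto
    then have "common_kernel v {i, j} = common_kernel v {i}"
      by (auto simp: common_kernel_def)
    then show False
      using dim[of "{i, j}"] dim[of "{i}"] ij D by simp
  qed
  have arr: "arrangement n (?h ` ?I)"
    using nz inj by (auto simp: arrangement_def card_image intro: rproj_hyperplane_normal)
  have point: "\<exists>q. \<Inter>\<B> = {q}" if \<B>: "\<B> \<subseteq> ?h ` ?I" "card \<B> = ?D - 1" for \<B>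
  proof -
    obtain J where J: "J \<subseteq> ?I" "\<B> = ?h ` J"
      using \<B>(1) by (meson subset_imageE)
    then have "card J = ?D - 1"
      using \<B>(2) inj by (metis card_image inj_on_subset)
    then have K: "dim (common_kernel v J) = 1"
      using dim[OF J(1)] D by linarith
    have K_line: "line_of (Abs_rproj (common_kernel v J)) = common_kernel v J"
      by (rule Abs_rproj_inverse) (simp add: K subspace_common_kernel del: One_nat_def)
    have "q \<in> \<Inter>\<B> \<longleftrightarrow> line_of q \<subseteq> common_kernel v J" for q
      unfolding J(2) by (auto simp: normal_hyperplane_def common_kernel_def)
    also have "line_of q \<subseteq> common_kernel v J \<longleftrightarrow> q = Abs_rproj (common_kernel v J)" for q
    proof
      assume "line_of q \<subseteq> common_kernel v J"
      then have "line_of q = common_kernel v J"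
        using line_of[of q] K by (intro subspace_dim_equal subspace_common_kernel) auto
      then show "q = Abs_rproj (common_kernel v J)"
        using K_line line_of_inject by metis
    qed (use K_line in simp)
    finally have "\<Inter>\<B> = {Abs_rproj (common_kernel v J)}"
      by blast
    then show ?thesis by blast
  qed
  have "2 * num_regions (?h ` ?I) + 2 * (\<Sum>k\<in>C. (card {i\<in>?I. c i = k} - 1) choose (?D - 1)) =
      max_cells n ?D"
    using two_num_regions[of ?I 0 v] card_sign_sets_pencils[OF _ assms(3,4) D p(1) v] assms(2) by simp
  then show ?thesis
    using arr point by blast
qed

text \<open>The upper bound on the regions also makes the set under \<open>Max\<close> finite. It is
  attained by the identity colouring, whose classes are singletons and lose nothing.\<close>

lemma two_f_max:
  assumes D: "DIM('a::euclidean_space) \<ge> 3" and "n > 0"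
  shows "2 * f_max TYPE('a) n = max_cells n DIM('a)"
proof -
  let ?S = "{num_regions \<A> | \<A> :: 'a rproj set set. arrangement n \<A>}"
  have bound: "2 * r \<le> max_cells n DIM('a)" if "r \<in> ?S" for r
    using that two_num_regions_le[OF _ assms(2)] by blast
  then have "?S \<subseteq> {..max_cells n DIM('a)}"
    by fastforce
  then have fin: "finite ?S"
    using finite_subset by blast
  have "(card {i\<in>{..<n}. id i = k} - 1) choose (DIM('a) - 1) = 0" if "k \<in> {..<n}" for k
  proof -
    have "{i\<in>{..<n}. id i = k} = {k}" using that by auto
    then show ?thesis using D by (simp add: binomial_eq_0)
  qed
  then have no_loss: "(\<Sum>k\<in>{..<n}. (card {i\<in>{..<n}. id i = k} - 1) choose (DIM('a) - 1)) = 0"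
    by (intro sum.neutral) blast
  have id: "id ` {..<n} \<subseteq> {..<n}" by simp
  obtain \<A> :: "'a rproj set set" where A: "arrangement n \<A>" "2 * num_regions \<A> = max_cells n DIM('a)"
    using exists_arrangement_of_colouring[OF D assms(2) finite_lessThan id] unfolding no_loss by auto
  have "f_max TYPE('a) n = num_regions \<A>"
    unfolding f_max_def
  proof (rule Max_eqI[OF fin])
    show "r \<le> num_regions \<A>" if "r \<in> ?S" for r
      using bound[OF that] A(2) by simp
  qed (use A(1) in blast)
  then show ?thesis using A(2) by simp
qed

theorem theorem1:
  fixes d :: nat and b :: real
  assumes "d \<ge> 4"
    and "CARD('n::finite) = d + 1"
    and "b = (real d - 1) / real d"
  shows "\<exists>(\<epsilon> :: nat \<Rightarrow> real) (n\<^sub>0 :: nat). \<epsilon> \<longlonglongrightarrow> 0 \<and>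
    (\<forall>n\<ge>n\<^sub>0. \<forall>a. a = (real d + 1) * (1 + \<epsilon> n) \<longrightarrow>
      (\<forall>N::nat. N \<le> nat \<lfloor>real n - a * real n powr b\<rfloor> choose d \<longrightarrow>
        (\<exists>\<A> :: (real ^ 'n) rproj set set. arrangement n \<A> \<and>
           int (num_regions \<A>) = int (f_max TYPE(real ^ 'n) n) - int N \<and>
           (\<forall>\<B>\<subseteq>\<A>. card \<B> = d \<longrightarrow> (\<exists>p. \<Inter>\<B> = {p})))))"
proof -
  have dim: "DIM(real ^ 'n) = d + 1"
    using assms(2) by simp
  then have D: "DIM(real ^ 'n) \<ge> 3"
    using assms(1) by simp
  have "\<forall>\<^sub>F n in sequentially. n > 0 \<and>
      (\<forall>N \<le> nat \<lfloor>real n - (real d + 1) * real n powr b\<rfloor> choose d. binomial_rep d N n)"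
    using eventually_gt_at_top binomial_rep_asymptotic[OF assms(1,3)] by (rule eventually_conj)
  then obtain n\<^sub>0 where n\<^sub>0: "\<And>n N. n \<ge> n\<^sub>0 \<Longrightarrow> n > 0"
    "\<And>n N. n \<ge> n\<^sub>0 \<Longrightarrow> N \<le> nat \<lfloor>real n - (real d + 1) * real n powr b\<rfloor> choose d \<Longrightarrow> binomial_rep d N n"
    unfolding eventually_sequentially by blast
  have "\<exists>\<A> :: (real ^ 'n) rproj set set. arrangement n \<A> \<and>
      int (num_regions \<A>) = int (f_max TYPE(real ^ 'n) n) - int N \<and>
      (\<forall>\<B>\<subseteq>\<A>. card \<B> = d \<longrightarrow> (\<exists>p. \<Inter>\<B> = {p}))"
    if n: "n \<ge> n\<^sub>0" "N \<le> nat \<lfloor>real n - (real d + 1) * real n powr b\<rfloor> choose d" for n N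
  proof -
    have "d \<ge> 1" using assms(1) by simp
    then obtain c :: "nat \<Rightarrow> nat" and C where C: "finite C" "c ` {..<n} \<subseteq> C"
      "(\<Sum>k\<in>C. (card {i\<in>{..<n}. c i = k} - 1) choose d) = N"
      using binomial_rep_colouring[OF n\<^sub>0(2)[OF n]] by blast
    then obtain \<A> :: "(real ^ 'n) rproj set set" where A: "arrangement n \<A>"
      "2 * num_regions \<A> + 2 * N = max_cells n DIM(real ^ 'n)"
      "\<forall>\<B>\<subseteq>\<A>. card \<B> = d \<longrightarrow> (\<exists>q. \<Inter>\<B> = {q})"
      using exists_arrangement_of_colouring[OF D n\<^sub>0(1)[OF n(1)] C(1,2)] unfolding dim by auto
    moreover have "int (num_regions \<A>) = int (f_max TYPE(real ^ 'n) n) - int N"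
      using A(2) two_f_max[OF D n\<^sub>0(1)[OF n(1)]] by simp
    ultimately show ?thesis by blast
  qed
  then show ?thesis
    by (intro exI[of _ "\<lambda>_. 0"] exI[of _ n\<^sub>0]) simp
qed

end
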